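(* Fix $t_0\in(0,+\infty)$. Suppose that $0\le A(t)\in L^\infty_{\mathrm{loc}}([t_0,+\infty))$, $A\not\equiv0$ (in the $L^\infty_{\mathrm{loc}}$ sense), $0\le v(t)\in L^\infty_{\mathrm{loc}}([t_0,+\infty))$ and $1/v\in L^\infty_{\mathrm{loc}}([t_0,+\infty))$, and let $z_0\in\mathbb{R}\backslash\{0\}$. Assume that either $$\frac1{v(t)}\notin L^1(+\infty),\qquad A(t)v(t)\notin L^1(+\infty),$$ or $$\frac1{v(t)}\in L^1(+\infty),\qquad\limsup_{t\to+\infty}\int_T^t\big(\sqrt{A(s)}-\sqrt{\chi(s)}\big)ds=+\infty$$ for some (hence any) $T>t_0$. Then every solution $z(t)\in\mathrm{Lip}_{\mathrm{loc}}([t_0,+\infty))$ of $$\begin{cases}(v(t)z'(t))'+A(t)v(t)z(t)=0&\text{a.e. on }(t_0,+\infty)\\ z(t_0)=z_0\end{cases}$$ is oscillatory.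
   Context: A function is in $L^1(+\infty)$ if it is integrable on $[R,+\infty)$ for some large $R$. When $1/v\in L^1(+\infty)$, $\chi(t)=\Big(2v(t)\int_t^{+\infty}\frac{ds}{v(s)}\Big)^{-2}$. $\mathrm{Lip}_{\mathrm{loc}}$ denotes locally Lipschitz functions. The equation is understood in the integrated sense: $vz'$ agrees a.e. with a locally absolutely continuous function whose derivative equals $-Avz$ a.e. Oscillatory means having zeros at arbitrarily large $t$ (not of eventually constant sign). *)

theory Defs
  imports "HOL-Analysis.Analysis"
begin

definition Linf_loc :: "real set \<Rightarrow> (real \<Rightarrow> real) \<Rightarrow> bool" where
  "Linf_loc S f \<longleftrightarrow>
     f \<in> borel_measurable (lebesgue_on S) \<and>
     (\<forall>K. compact K \<and> K \<subseteq> S \<longrightarrow> (\<exists>C. AE t in lebesgue_on K. \<bar>f t\<bar> \<le> C))"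

(* Since 1 / 0 = 0 in HOL, the fact that 1 / v is finite a.e., which is part of
   1 / v being locally essentially bounded, has to be stated separately. *)
definition recip_Linf_loc :: "real set \<Rightarrow> (real \<Rightarrow> real) \<Rightarrow> bool" where
  "recip_Linf_loc S v \<longleftrightarrow>
     (AE t in lebesgue_on S. v t \<noteq> 0) \<and> Linf_loc S (\<lambda>t. 1 / v t)"

definition L1_at_infinity :: "(real \<Rightarrow> real) \<Rightarrow> bool" where
  "L1_at_infinity f \<longleftrightarrow> (\<exists>R. set_integrable lebesgue {R..} f)"

(* Only meaningful when 1 / v is integrable at infinity. *)
definition chi :: "(real \<Rightarrow> real) \<Rightarrow> real \<Rightarrow> real" where
  "chi v t = (2 * v t * (LINT s:{t..}|lebesgue. 1 / v s)) powi (-2)"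

definition Lip_loc :: "real set \<Rightarrow> (real \<Rightarrow> real) \<Rightarrow> bool" where
  "Lip_loc S f \<longleftrightarrow> (\<forall>x\<in>S. \<exists>u>0. \<exists>L. L-lipschitz_on (cball x u \<inter> S) f)"

(* A finite family of non-overlapping intervals is encoded as the finite set D of
   its pairs of endpoints. *)
definition abs_continuous_on :: "real set \<Rightarrow> (real \<Rightarrow> real) \<Rightarrow> bool" where
  "abs_continuous_on S f \<longleftrightarrow>
     (\<forall>\<epsilon>>0. \<exists>\<delta>>0. \<forall>D. finite D \<and>
        (\<forall>(a, b)\<in>D. a \<le> b \<and> {a..b} \<subseteq> S) \<and>
        disjoint_family_on (\<lambda>(a, b). {a<..<b}) D \<and>
        (\<Sum>(a, b)\<in>D. b - a) < \<delta>
        \<longrightarrow> (\<Sum>(a, b)\<in>D. \<bar>f b - f a\<bar>) < \<epsilon>)"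

definition loc_abs_continuous_on :: "real set \<Rightarrow> (real \<Rightarrow> real) \<Rightarrow> bool" where
  "loc_abs_continuous_on S f \<longleftrightarrow> (\<forall>a b. {a..b} \<subseteq> S \<longrightarrow> abs_continuous_on {a..b} f)"

(* The equation (v z')' + A v z = 0 a.e. on (t0, +\<infinity>): w is the locally absolutely
   continuous representative of v z'. *)
definition solves_ode :: "real \<Rightarrow> (real \<Rightarrow> real) \<Rightarrow> (real \<Rightarrow> real) \<Rightarrow> (real \<Rightarrow> real) \<Rightarrow> bool" where
  "solves_ode t0 A v z \<longleftrightarrow>
     (\<exists>w. loc_abs_continuous_on {t0<..} w \<and>
        (AE t in lebesgue_on {t0<..}.
           \<exists>z'. (z has_real_derivative z') (at t) \<and> w t = v t * z') \<and>
        (AE t in lebesgue_on {t0<..}.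
           (w has_real_derivative - (A t * v t * z t)) (at t)))"

definition oscillatory :: "real \<Rightarrow> (real \<Rightarrow> real) \<Rightarrow> bool" where
  "oscillatory t0 z \<longleftrightarrow> (\<forall>T\<ge>t0. \<exists>t\<ge>T. z t = 0)"

end

theory Submission
  imports Defs
begin

text \<open>
  Suppose that \<open>z\<close> has no zero on \<open>[a, \<infinity>)\<close>. Then \<open>y = - v z' / z\<close> is locally absolutely
  continuous there and satisfies the Riccati equation \<open>y' = A v + y\<^sup>2 / v\<close>, so \<open>y\<close> is nondecreasing.
  If \<open>y s > 0\<close> for some \<open>s\<close>, integrating \<open>(- 1 / y)' \<ge> 1 / v\<close> gives \<open>1 / v \<in> L\<^sup>1\<close> together with
  \<open>r t = \<integral>\<^sub>t\<^sup>\<infinity> 1 / v \<le> 1 / y t\<close>, while \<open>(ln y)' = A v / y + y / v \<ge> 2 \<surd>A\<close> gives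
  \<open>2 \<integral> \<surd>A \<le> ln (y t) + const \<le> - ln (r t) + const\<close>, and the right-hand side is
  \<open>2 \<integral> \<surd>\<chi> + const\<close> because \<open>\<surd>\<chi> = - r' / (2 r)\<close>. If \<open>y \<le> 0\<close> throughout, \<open>y' \<ge> A v\<close> gives
  \<open>A v \<in> L\<^sup>1\<close>, and \<open>\<surd>A \<le> (A v + 1 / v) / 2\<close> bounds \<open>\<integral> \<surd>A\<close> when \<open>1 / v \<in> L\<^sup>1\<close>. Either way both
  alternatives of the hypothesis fail.
\<close>

subsection \<open>Absolutely continuous functions\<close>

text \<open>Disjoint intervals have total length equal to the measure of their union, which lies in
  \<open>U\<close>. This turns an open cover of small measure into the length condition of absolute
  continuity.\<close>

lemma sum_length_le_measure:
  fixes D :: "(real \<times> real) set"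
  assumes "finite D" and D: "\<And>a b. (a, b) \<in> D \<Longrightarrow> a \<le> b \<and> {a<..<b} \<subseteq> U"
    and disj: "disjoint_family_on (\<lambda>(a, b). {a<..<b}) D"
    and U: "U \<in> lmeasurable"
  shows "(\<Sum>(a, b)\<in>D. b - a) \<le> measure lebesgue U"
proof -
  have "(\<Sum>(a, b)\<in>D. b - a) = (\<Sum>d\<in>D. measure lebesgue (case d of (a, b) \<Rightarrow> {a<..<b}))"
    using D by (intro sum.cong) auto
  also have "\<dots> = measure lebesgue (\<Union>d\<in>D. case d of (a, b) \<Rightarrow> {a<..<b})"
  proof (intro measure_finite_Union[symmetric])
    show "emeasure lebesgue (case d of (a, b) \<Rightarrow> {a<..<b}) \<noteq> \<infinity>" if "d \<in> D" for d
      using D[of "fst d" "snd d"] that by (auto split: prod.splits)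
  qed (use assms(1) disj in \<open>auto split: prod.splits\<close>)
  also have "\<dots> \<le> measure lebesgue U"
    using assms(1) D U by (intro measure_mono_fmeasurable sets.finite_UN) (auto split: prod.splits)
  finally show ?thesis .
qed

lemma abs_continuous_onE:
  assumes "abs_continuous_on S f" "e > 0"
  obtains \<delta> where "\<delta> > 0"
    "\<And>D. finite D \<Longrightarrow> (\<And>u v. (u, v) \<in> D \<Longrightarrow> u \<le> v \<and> {u..v} \<subseteq> S) \<Longrightarrow>
      disjoint_family_on (\<lambda>(u, v). {u<..<v}) D \<Longrightarrow> (\<Sum>(u, v)\<in>D. v - u) < \<delta> \<Longrightarrow>
      (\<Sum>(u, v)\<in>D. \<bar>f v - f u\<bar>) < e"
proof -
  from assms obtain \<delta> where "\<delta> > 0" and \<delta>: "\<forall>D. finite D \<and> (\<forall>(u, v)\<in>D. u \<le> v \<and> {u..v} \<subseteq> S) \<and>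
      disjoint_family_on (\<lambda>(u, v). {u<..<v}) D \<and> (\<Sum>(u, v)\<in>D. v - u) < \<delta>
      \<longrightarrow> (\<Sum>(u, v)\<in>D. \<bar>f v - f u\<bar>) < e"
    unfolding abs_continuous_on_def by meson
  show thesis
  proof (rule that[OF \<open>\<delta> > 0\<close>])
    fix D assume "finite D" "\<And>u v. (u, v) \<in> D \<Longrightarrow> u \<le> v \<and> {u..v} \<subseteq> S"
      "disjoint_family_on (\<lambda>(u, v). {u<..<v}) D" "(\<Sum>(u, v)\<in>D. v - u) < \<delta>"
    then show "(\<Sum>(u, v)\<in>D. \<bar>f v - f u\<bar>) < e"
      by (intro \<delta>[rule_format]) auto
  qed
qed

text \<open>
  As in the proof of the fundamental theorem for the gauge integral, but tags in \<open>N\<close> get a gauge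
  inside an open set of small measure, so that absolute continuity controls their total contribution.
\<close>
lemma abs_continuous_on_has_integral:
  assumes "a \<le> b" and ac: "abs_continuous_on {a..b} f" and N: "negligible N"
    and der: "\<And>x. x \<in> {a..b} - N \<Longrightarrow> (f has_real_derivative f' x) (at x)"
  shows "(f' has_integral f b - f a) {a..b}"
proof -
  \<comment> \<open>With value 0 on \<open>N\<close>, a tag in \<open>N\<close> leaves only the
    increment of \<open>f\<close> to be estimated.\<close>
  define g where "g x = (if x \<in> N then 0 else f' x)" for x
  have "(g has_integral f b - f a) {a..b}"
    unfolding has_integral_real
  proof (intro allI impI)
    fix e :: real assume e: "e > 0"
    \<comment> \<open>Derivative errors summed over the whole interval stay below
      \<open>e / 2\<close>; the summand 1 covers \<open>a = b\<close>.\<close>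
    define e' where "e' = e / (2 * (b - a + 1))"
    have e': "e' > 0" using e \<open>a \<le> b\<close> by (simp add: e'_def)
    have "e' * (b - a) < e / 2"
      using e \<open>a \<le> b\<close> by (simp add: e'_def field_simps)
    have "\<exists>d>0. x \<in> {a..b} - N \<longrightarrow> (\<forall>y. \<bar>y - x\<bar> < d \<longrightarrow> \<bar>f y - f x - (y - x) * f' x\<bar> \<le> e' * \<bar>y - x\<bar>)" for x
    proof (cases "x \<in> {a..b} - N")
      case True
      then show ?thesis
        using der[OF True] e'
        unfolding has_field_derivative_def has_derivative_at_alt by (simp add: mult.commute)
    qed (auto intro: exI[of _ 1])
    then obtain d where d: "\<And>x. d x > 0"
      "\<And>x y. x \<in> {a..b} - N \<Longrightarrow> \<bar>y - x\<bar> < d x \<Longrightarrow> \<bar>f y - f x - (y - x) * f' x\<bar> \<le> e' * \<bar>y - x\<bar>"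
      by metis
    obtain \<delta> where "\<delta> > 0" and \<delta>: "\<And>D. finite D \<Longrightarrow> (\<And>u v. (u, v) \<in> D \<Longrightarrow> u \<le> v \<and> {u..v} \<subseteq> {a..b}) \<Longrightarrow>
        disjoint_family_on (\<lambda>(u, v). {u<..<v}) D \<Longrightarrow> (\<Sum>(u, v)\<in>D. v - u) < \<delta> \<Longrightarrow>
        (\<Sum>(u, v)\<in>D. \<bar>f v - f u\<bar>) < e / 2"
      using abs_continuous_onE[OF ac, of "e/2"] e by (metis half_gt_zero)
    obtain U where U: "open U" "N \<subseteq> U" "U \<in> lmeasurable" "measure lebesgue U < \<delta>"
    proof -
      have N0: "N \<in> null_sets lebesgue" using N negligible_iff_null_sets by blast
      obtain U where U: "open U" "N \<subseteq> U" "U - N \<in> lmeasurable" "emeasure lebesgue (U - N) < ennreal \<delta>"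
        using sets_lebesgue_outer_open[of N \<delta>] N0 \<open>\<delta> > 0\<close> by blast
      have "emeasure lebesgue (U - N) = emeasure lebesgue U"
        using U(1) by (intro emeasure_Diff_null_set[OF N0]) auto
      then have "emeasure lebesgue U < ennreal \<delta>" using U by simp
      moreover from this have "U \<in> lmeasurable"
        using U(1) by (intro fmeasurableI) (auto intro: order_less_trans)
      ultimately show ?thesis using that[of U] U \<open>\<delta> > 0\<close>
        by (simp add: emeasure_eq_measure2 ennreal_less_iff)
    qed
    have "\<exists>s>0. x \<in> U \<longrightarrow> ball x s \<subseteq> U" for x
      using U(1) by (cases "x \<in> U") (auto simp: open_contains_ball intro: exI[of _ 1])
    then obtain s where s: "\<And>x. s x > 0" "\<And>x. x \<in> U \<Longrightarrow> ball x (s x) \<subseteq> U" by metis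
    define \<gamma> where "\<gamma> x = ball x (if x \<in> N then s x else d x)" for x
    have "gauge \<gamma>" unfolding \<gamma>_def gauge_def using s(1) d(1) by auto
    moreover have "norm ((\<Sum>(x, K)\<in>p. measure lborel K *\<^sub>R g x) - (f b - f a)) < e"
      if p: "p tagged_division_of {a..b}" "\<gamma> fine p" for p
    proof -
      have fin: "finite p" using p by blast
      have pK: "K = {Inf K..Sup K} \<and> Inf K \<le> Sup K \<and> x \<in> K \<and> K \<subseteq> {a..b} \<and> K \<subseteq> \<gamma> x" if "(x, K) \<in> p" for x K
      proof -
        from p that obtain u v where uv: "K = cbox u v" by blast
        moreover have "x \<in> K" "K \<subseteq> {a..b}" "K \<subseteq> \<gamma> x" using p that by blast+
        ultimately show ?thesis by auto
      qed
      have int0: "interior K1 \<inter> interior K2 = {}" if "(x1, K1) \<in> p" "(x2, K2) \<in> p" "(x1, K1) \<noteq> (x2, K2)" for x1 x2 K1 K2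
        using p(1) that unfolding tagged_division_of by blast
      have fs: "f b - f a = (\<Sum>(x, K)\<in>p. f (Sup K) - f (Inf K))"
        using additive_tagged_division_1[where f=f] \<open>a \<le> b\<close> p by auto
      have bs: "b - a = (\<Sum>(x, K)\<in>p. Sup K - Inf K)"
        using additive_tagged_division_1[where f="\<lambda>x. x"] \<open>a \<le> b\<close> p by auto
      define P where "P = {(x, K) \<in> p. x \<in> N}"
      define D where "D = (\<lambda>(x, K). (Inf K, Sup K)) ` P"
      have Pp: "P \<subseteq> p" unfolding P_def by auto
      then have finP: "finite P" using fin finite_subset by blast
      \<comment> \<open>Forgetting tags loses no interval: a nondegenerate one cannot occur twice
        because interiors are disjoint, and a degenerate one contains only one possible tag.\<close>
      have inj: "inj_on (\<lambda>(x, K). (Inf K, Sup K)) P"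
      proof (rule inj_onI, clarify)
        fix x1 K1 x2 K2
        assume A: "(x1, K1) \<in> P" "(x2, K2) \<in> P" "Inf K1 = Inf K2" "Sup K1 = Sup K2"
        then have P: "(x1, K1) \<in> p" "(x2, K2) \<in> p" using Pp by auto
        from pK[OF P(1)] pK[OF P(2)] A have K: "K1 = K2" by metis
        show "x1 = x2 \<and> K1 = K2"
        proof (rule ccontr)
          assume "\<not> ?thesis"
          then have "interior K1 = {}" using int0[OF P] K by auto
          with pK[OF P(1)] have "Inf K1 = Sup K1"
            by (metis interior_atLeastAtMost_real greaterThanLessThan_empty_iff order_antisym)
          with pK[OF P(1)] pK[OF P(2)] K \<open>\<not> ?thesis\<close> show False
            by (metis atLeastAtMost_singleton singletonD)
        qed
      qed
      have "(\<Sum>(u, v)\<in>D. \<bar>f v - f u\<bar>) < e / 2"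
      proof (rule \<delta>)
        show "finite D" using finP D_def by simp
        show "u \<le> v \<and> {u..v} \<subseteq> {a..b}" if "(u, v) \<in> D" for u v
          using that pK Pp unfolding D_def by fastforce
        have "{Inf K1<..<Sup K1} \<inter> {Inf K2<..<Sup K2} = {}"
          if "(x1, K1) \<in> P" "(x2, K2) \<in> P" "(Inf K1, Sup K1) \<noteq> (Inf K2, Sup K2)" for x1 K1 x2 K2
        proof -
          have P: "(x1, K1) \<in> p" "(x2, K2) \<in> p" using that Pp by auto
          have "interior K1 = {Inf K1<..<Sup K1}" "interior K2 = {Inf K2<..<Sup K2}"
            using pK[OF P(1)] pK[OF P(2)] by (metis interior_atLeastAtMost_real)+
          then show ?thesis using int0[OF P] that by auto
        qed
        then show disj: "disjoint_family_on (\<lambda>(u, v). {u<..<v}) D"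
          unfolding disjoint_family_on_def D_def by fast
        have "(\<Sum>(u, v)\<in>D. v - u) \<le> measure lebesgue U"
        proof (rule sum_length_le_measure[OF \<open>finite D\<close> _ disj U(3)])
          fix u v assume "(u, v) \<in> D"
          then obtain x K where K: "(x, K) \<in> P" "u = Inf K" "v = Sup K" unfolding D_def by auto
          then have "(x, K) \<in> p" "x \<in> N" using P_def by auto
          moreover have "ball x (s x) \<subseteq> U" using s U \<open>x \<in> N\<close> by auto
          ultimately have "K \<subseteq> U" using pK[of x K] unfolding \<gamma>_def by auto
          moreover have "{u..v} = K" "u \<le> v"
            using pK[OF \<open>(x, K) \<in> p\<close>] K by auto
          ultimately show "u \<le> v \<and> {u<..<v} \<subseteq> U"
            by (metis greaterThanLessThan_subseteq_atLeastAtMost_iff order_refl order_trans)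
        qed
        then show "(\<Sum>(u, v)\<in>D. v - u) < \<delta>" using U by simp
      qed
      then have bad: "(\<Sum>(x, K)\<in>P. \<bar>f (Sup K) - f (Inf K)\<bar>) < e / 2"
        unfolding D_def by (subst (asm) sum.reindex[OF inj]) (simp add: case_prod_unfold)
      have cont: "measure lborel K = Sup K - Inf K" if "(x, K) \<in> p" for x K
        using pK[OF that] by (metis content_real)
      have "\<bar>measure lborel K * g x - (f (Sup K) - f (Inf K))\<bar>
          \<le> e' * (Sup K - Inf K) + (if x \<in> N then \<bar>f (Sup K) - f (Inf K)\<bar> else 0)" if xK: "(x, K) \<in> p" for x K
      proof (cases "x \<in> N")
        case True
        moreover have "e' * (Sup K - Inf K) \<ge> 0" using e' pK[OF xK] by simp
        ultimately show ?thesis by (simp add: g_def abs_minus_commute)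
      next
        case False
        define u v where "u = Inf K" and "v = Sup K"
        have uv: "K = {u..v}" "u \<le> v" "x \<in> {u..v}" "{u..v} \<subseteq> {a..b}" "{u..v} \<subseteq> ball x (d x)"
          using pK[OF xK] False unfolding u_def v_def \<gamma>_def by auto
        have x: "x \<in> {a..b} - N" using uv False by auto
        have "u \<in> {u..v}" "v \<in> {u..v}" using uv(2) by simp_all
        then have "u \<in> ball x (d x)" "v \<in> ball x (d x)" using uv(5) by blast+
        then have "\<bar>u - x\<bar> < d x" "\<bar>v - x\<bar> < d x" by (auto simp: dist_real_def)
        \<comment> \<open>The tag lies between the endpoints, so the errors at \<open>u\<close> and
          \<open>v\<close> add up to exactly \<open>e' * (v - u)\<close>.\<close>
        from d(2)[OF x this(1)] d(2)[OF x this(2)]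
        have "\<bar>(v - u) * f' x - (f v - f u)\<bar> \<le> e' * \<bar>u - x\<bar> + e' * \<bar>v - x\<bar>"
          by (simp add: algebra_simps abs_le_iff)
        also have "\<dots> = e' * (v - u)" using uv by (simp add: algebra_simps)
        finally show ?thesis using False cont[OF xK] by (simp add: g_def u_def v_def)
      qed
      then have "(\<Sum>(x, K)\<in>p. \<bar>measure lborel K * g x - (f (Sup K) - f (Inf K))\<bar>)
          \<le> (\<Sum>(x, K)\<in>p. e' * (Sup K - Inf K) + (if x \<in> N then \<bar>f (Sup K) - f (Inf K)\<bar> else 0))"
        by (intro sum_mono) auto
      also have "\<dots> = e' * (b - a) + (\<Sum>(x, K)\<in>P. \<bar>f (Sup K) - f (Inf K)\<bar>)"
        unfolding bs P_def sum_distrib_left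
        by (simp add: case_prod_unfold sum.distrib sum.inter_filter[OF fin, symmetric])
      also have "\<dots> < e" using bad \<open>e' * (b - a) < e / 2\<close> by simp
      finally have "(\<Sum>(x, K)\<in>p. \<bar>measure lborel K * g x - (f (Sup K) - f (Inf K))\<bar>) < e" .
      moreover have "norm ((\<Sum>(x, K)\<in>p. measure lborel K *\<^sub>R g x) - (f b - f a))
          = \<bar>\<Sum>(x, K)\<in>p. measure lborel K * g x - (f (Sup K) - f (Inf K))\<bar>"
        unfolding fs by (simp add: case_prod_unfold sum_subtractf)
      moreover have "\<dots> \<le> (\<Sum>(x, K)\<in>p. \<bar>measure lborel K * g x - (f (Sup K) - f (Inf K))\<bar>)"
        unfolding case_prod_unfold by (rule sum_abs)
      ultimately show ?thesis by linarith
    qed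
    ultimately show "\<exists>\<gamma>. gauge \<gamma> \<and> (\<forall>\<D>. \<D> tagged_division_of {a..b} \<and> \<gamma> fine \<D> \<longrightarrow>
        norm ((\<Sum>(x, k)\<in>\<D>. measure lborel k *\<^sub>R g x) - (f b - f a)) < e)"
      by (intro exI[of _ \<gamma>] conjI allI impI) (assumption, elim conjE)
  qed
  then show ?thesis
    by (rule has_integral_spike[OF N, rotated]) (simp add: g_def)
qed

text \<open>The derivative integrates to the increment, so a lower bound for it almost everywhere
  bounds the increment from below. Every differential inequality for \<open>y\<close> is integrated
  this way.\<close>

lemma abs_continuous_on_integral_le:
  assumes "a \<le> b" and ac: "abs_continuous_on {a..b} f" and N: "negligible N"
    and der: "\<And>x. x \<in> {a..b} - N \<Longrightarrow> \<exists>d. (f has_real_derivative d) (at x) \<and> g x \<le> d"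
    and g: "g integrable_on {a..b}"
  shows "integral {a..b} g \<le> f b - f a"
proof -
  obtain h where h: "\<And>x. x \<in> {a..b} - N \<Longrightarrow> (f has_real_derivative h x) (at x) \<and> g x \<le> h x"
    using der by metis
  \<comment> \<open>Taking the value of \<open>g\<close> on \<open>N\<close> makes the comparison
    hold at every point.\<close>
  have "((\<lambda>x. if x \<in> N then g x else h x) has_integral f b - f a) {a..b}"
    using h by (intro abs_continuous_on_has_integral[OF assms(1) ac N]) auto
  then show ?thesis
    using h by (intro has_integral_le[OF integrable_integral[OF g]]) auto
qed

text \<open>Small increment sums of \<open>g\<close> and \<open>h\<close> force small ones of
  \<open>f\<close>. Two majorants are allowed because a quotient \<open>w / z\<close> is controlled
  by \<open>w\<close> and, through the Lipschitz function \<open>z\<close>, by the identity.\<close>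

lemma abs_continuous_on_dominated:
  assumes g: "abs_continuous_on {a..b} g" and h: "abs_continuous_on {a..b} h"
    and bound: "\<And>x y. x \<in> {a..b} \<Longrightarrow> y \<in> {a..b} \<Longrightarrow> \<bar>f y - f x\<bar> \<le> C * \<bar>g y - g x\<bar> + C * \<bar>h y - h x\<bar>"
  shows "abs_continuous_on {a..b} f"
  unfolding abs_continuous_on_def
proof (intro allI impI)
  fix e :: real assume e: "e > 0"
  \<comment> \<open>A positive majorant of \<open>C\<close>, by which it is safe to divide.\<close>
  define c where "c = \<bar>C\<bar> + 1"
  have c: "c > 0" "C \<le> c" by (auto simp: c_def)
  define e' where "e' = e / (2 * c)"
  have e': "e' > 0" using e c by (simp add: e'_def)
  obtain d1 where d1: "d1 > 0" "\<And>D. finite D \<Longrightarrow> (\<And>u v. (u, v) \<in> D \<Longrightarrow> u \<le> v \<and> {u..v} \<subseteq> {a..b}) \<Longrightarrow>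
      disjoint_family_on (\<lambda>(u, v). {u<..<v}) D \<Longrightarrow> (\<Sum>(u, v)\<in>D. v - u) < d1 \<Longrightarrow>
      (\<Sum>(u, v)\<in>D. \<bar>g v - g u\<bar>) < e'"
    using abs_continuous_onE[OF g e'] by metis
  obtain d2 where d2: "d2 > 0" "\<And>D. finite D \<Longrightarrow> (\<And>u v. (u, v) \<in> D \<Longrightarrow> u \<le> v \<and> {u..v} \<subseteq> {a..b}) \<Longrightarrow>
      disjoint_family_on (\<lambda>(u, v). {u<..<v}) D \<Longrightarrow> (\<Sum>(u, v)\<in>D. v - u) < d2 \<Longrightarrow>
      (\<Sum>(u, v)\<in>D. \<bar>h v - h u\<bar>) < e'"
    using abs_continuous_onE[OF h e'] by metis
  show "\<exists>\<delta>>0. \<forall>D. finite D \<and>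
        (\<forall>(u, v)\<in>D. u \<le> v \<and> {u..v} \<subseteq> {a..b}) \<and>
        disjoint_family_on (\<lambda>(u, v). {u<..<v}) D \<and>
        (\<Sum>(u, v)\<in>D. v - u) < \<delta> \<longrightarrow> (\<Sum>(u, v)\<in>D. \<bar>f v - f u\<bar>) < e"
  proof (intro exI[of _ "min d1 d2"] conjI allI impI)
    show "min d1 d2 > 0" using d1 d2 by simp
    fix D assume D: "finite D \<and>
        (\<forall>(u, v)\<in>D. u \<le> v \<and> {u..v} \<subseteq> {a..b}) \<and>
        disjoint_family_on (\<lambda>(u, v). {u<..<v}) D \<and>
        (\<Sum>(u, v)\<in>D. v - u) < min d1 d2"
    have gh: "(\<Sum>(u, v)\<in>D. \<bar>g v - g u\<bar>) < e'" "(\<Sum>(u, v)\<in>D. \<bar>h v - h u\<bar>) < e'"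
      using D by (intro d1(2) d2(2); auto)+
    have "(\<Sum>(u, v)\<in>D. \<bar>f v - f u\<bar>) \<le> (\<Sum>(u, v)\<in>D. c * \<bar>g v - g u\<bar> + c * \<bar>h v - h u\<bar>)"
    proof (intro sum_mono, clarify)
      fix u v assume "(u, v) \<in> D"
      then have "u \<in> {a..b}" "v \<in> {a..b}" using D by fastforce+
      from bound[OF this] show "\<bar>f v - f u\<bar> \<le> c * \<bar>g v - g u\<bar> + c * \<bar>h v - h u\<bar>"
        using mult_right_mono[OF c(2), of "\<bar>g v - g u\<bar>"] mult_right_mono[OF c(2), of "\<bar>h v - h u\<bar>"] by linarith
    qed
    also have "\<dots> = c * (\<Sum>(u, v)\<in>D. \<bar>g v - g u\<bar>) + c * (\<Sum>(u, v)\<in>D. \<bar>h v - h u\<bar>)"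
      by (simp add: case_prod_unfold sum.distrib sum_distrib_left)
    also have "\<dots> < c * e' + c * e'"
      using c gh by (intro add_strict_mono mult_strict_left_mono) auto
    also have "\<dots> = e" using c by (simp add: e'_def)
    finally show "(\<Sum>(u, v)\<in>D. \<bar>f v - f u\<bar>) < e" .
  qed
qed

lemma abs_continuous_on_ident: "abs_continuous_on S (\<lambda>x. x)"
  unfolding abs_continuous_on_def
proof (intro allI impI)
  fix e :: real assume "e > 0"
  have "(\<Sum>(a, b)\<in>D. \<bar>b - a\<bar>) = (\<Sum>(a, b)\<in>D. b - a)"
    if "\<forall>(a, b)\<in>D. a \<le> b \<and> {a..b} \<subseteq> S" for D
    using that by (intro sum.cong) auto
  then show "\<exists>\<delta>>0. \<forall>D. finite D \<and> (\<forall>(a, b)\<in>D. a \<le> b \<and> {a..b} \<subseteq> S) \<and>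
      disjoint_family_on (\<lambda>(a, b). {a<..<b}) D \<and> (\<Sum>(a, b)\<in>D. b - a) < \<delta>
      \<longrightarrow> (\<Sum>(a, b)\<in>D. \<bar>b - a\<bar>) < e"
    using \<open>e > 0\<close> by (intro exI[of _ e]) simp
qed

lemma abs_continuous_on_imp_continuous_on:
  assumes "abs_continuous_on {a..b} f"
  shows "continuous_on {a..b} f"
  unfolding continuous_on_iff
proof (intro ballI allI impI)
  fix x e :: real assume x: "x \<in> {a..b}" and "e > 0"
  obtain d where d: "d > 0" "\<And>D. finite D \<Longrightarrow> (\<And>u v. (u, v) \<in> D \<Longrightarrow> u \<le> v \<and> {u..v} \<subseteq> {a..b}) \<Longrightarrow>
      disjoint_family_on (\<lambda>(u, v). {u<..<v}) D \<Longrightarrow> (\<Sum>(u, v)\<in>D. v - u) < d \<Longrightarrow>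
      (\<Sum>(u, v)\<in>D. \<bar>f v - f u\<bar>) < e"
    using abs_continuous_onE[OF assms \<open>e > 0\<close>] by metis
  have "dist (f y) (f x) < e" if "y \<in> {a..b}" "dist y x < d" for y
    using d(2)[of "{(min x y, max x y)}"] x that
    by (cases "x \<le> y") (auto simp: disjoint_family_on_def dist_real_def min_def max_def)
  then show "\<exists>d>0. \<forall>y\<in>{a..b}. dist y x < d \<longrightarrow> dist (f y) (f x) < e"
    using d(1) by blast
qed

text \<open>Compactness of the interval. The library states this for functions that also depend on
  time, hence the single dummy time 0.\<close>

lemma Lip_loc_imp_lipschitz_on:
  assumes "Lip_loc S f" "{a..b} \<subseteq> S"
  obtains L where "L-lipschitz_on {a..b} f"
proof -
  have "local_lipschitz {0::real} {a..b} (\<lambda>_. f)"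
  proof (rule local_lipschitzI)
    fix x assume "x \<in> {a..b}"
    then obtain u L where "u > 0" "L-lipschitz_on (cball x u \<inter> S) f"
      using assms unfolding Lip_loc_def by blast
    then show "\<exists>u>0. \<exists>L. \<forall>t\<in>cball t u \<inter> {0}. L-lipschitz_on (cball x u \<inter> {a..b}) f" for t :: real
      using assms(2) by (meson Int_mono lipschitz_on_subset subset_refl)
  qed
  then show ?thesis
    using local_lipschitz_compact_implies_lipschitz[of "{0::real}" "{a..b}" "\<lambda>_. f"] that
    by (metis compact_Icc compact_sing continuous_on_const insertI1)
qed

subsection \<open>Locally essentially bounded functions\<close>

text \<open>Exceptional sets become explicit negligible sets, the form in which gauge integrals
  ignore them.\<close>

lemma AE_lebesgue_on_iff_negligible:
  assumes "S \<in> sets lebesgue"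
  shows "(AE x in lebesgue_on S. P x) \<longleftrightarrow> (\<exists>N. negligible N \<and> (\<forall>x\<in>S - N. P x))"
proof -
  have "(AE x in lebesgue_on S. P x) \<longleftrightarrow> (AE x in lebesgue. x \<in> S \<longrightarrow> P x)"
    using assms by (simp add: AE_restrict_space_iff)
  also have "\<dots> \<longleftrightarrow> (\<exists>N. negligible N \<and> (\<forall>x\<in>S - N. P x))"
  proof
    assume "AE x in lebesgue. x \<in> S \<longrightarrow> P x"
    then obtain N where "N \<in> null_sets lebesgue" "{x \<in> space lebesgue. \<not> (x \<in> S \<longrightarrow> P x)} \<subseteq> N"
      by (auto simp: eventually_ae_filter)
    then show "\<exists>N. negligible N \<and> (\<forall>x\<in>S - N. P x)"
      by (intro exI[of _ N]) (auto simp: negligible_iff_null_sets)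
  next
    assume "\<exists>N. negligible N \<and> (\<forall>x\<in>S - N. P x)"
    then show "AE x in lebesgue. x \<in> S \<longrightarrow> P x"
      by (auto simp: eventually_ae_filter negligible_iff_null_sets)
  qed
  finally show ?thesis .
qed

lemma Linf_loc_subset:
  assumes "Linf_loc S f" "T \<subseteq> S"
  shows "Linf_loc T f"
  using assms unfolding Linf_loc_def by (auto intro: measurable_restrict_mono)

lemma Linf_loc_mult:
  assumes "Linf_loc S f" "Linf_loc S g"
  shows "Linf_loc S (\<lambda>t. f t * g t)"
  unfolding Linf_loc_def
proof (intro conjI allI impI)
  show "(\<lambda>t. f t * g t) \<in> borel_measurable (lebesgue_on S)"
    using assms unfolding Linf_loc_def by auto
  fix K assume "compact K \<and> K \<subseteq> S"
  then obtain C D where C: "AE t in lebesgue_on K. \<bar>f t\<bar> \<le> C" and D: "AE t in lebesgue_on K. \<bar>g t\<bar> \<le> D"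
    using assms unfolding Linf_loc_def by meson
  from C D have "AE t in lebesgue_on K. \<bar>f t * g t\<bar> \<le> C * D"
    by eventually_elim (auto simp: abs_mult intro!: mult_mono)
  then show "\<exists>C. AE t in lebesgue_on K. \<bar>f t * g t\<bar> \<le> C" by blast
qed

text \<open>In HOL \<open>sqrt\<close> is odd, so
  \<open>\<bar>sqrt x\<bar> = sqrt \<bar>x\<bar>\<close> at negative arguments as well, and a bound
  \<open>C\<close> becomes \<open>sqrt C\<close>.\<close>

lemma Linf_loc_sqrt:
  assumes "Linf_loc S f"
  shows "Linf_loc S (\<lambda>t. sqrt (f t))"
  unfolding Linf_loc_def
proof (intro conjI allI impI)
  show "(\<lambda>t. sqrt (f t)) \<in> borel_measurable (lebesgue_on S)"
    using assms unfolding Linf_loc_def by auto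
  fix K assume "compact K \<and> K \<subseteq> S"
  then obtain C where C: "AE t in lebesgue_on K. \<bar>f t\<bar> \<le> C"
    using assms unfolding Linf_loc_def by meson
  then have "AE t in lebesgue_on K. \<bar>sqrt (f t)\<bar> \<le> sqrt C"
    by eventually_elim (simp add: real_sqrt_abs' flip: real_sqrt_abs2)
  then show "\<exists>C. AE t in lebesgue_on K. \<bar>sqrt (f t)\<bar> \<le> C" by blast
qed

lemma continuous_on_imp_Linf_loc:
  assumes "continuous_on S f" "S \<in> sets lebesgue"
  shows "Linf_loc S f"
  unfolding Linf_loc_def
proof (intro conjI allI impI)
  show "f \<in> borel_measurable (lebesgue_on S)"
    using assms by (rule continuous_imp_measurable_on_sets_lebesgue)
  fix K assume K: "compact K \<and> K \<subseteq> S"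
  then have "bounded (f ` K)"
    using assms(1) by (meson compact_continuous_image compact_imp_bounded continuous_on_subset)
  then obtain C where "\<forall>t\<in>K. \<bar>f t\<bar> \<le> C" unfolding bounded_iff by auto
  then show "\<exists>C. AE t in lebesgue_on K. \<bar>f t\<bar> \<le> C"
    by (intro exI[of _ C] AE_I2) auto
qed

lemma Linf_loc_absolutely_integrable:
  assumes "Linf_loc S f" "{a..b} \<subseteq> S"
  shows "f absolutely_integrable_on {a..b}"
proof -
  have f: "f \<in> borel_measurable (lebesgue_on {a..b})"
    using assms unfolding Linf_loc_def by (auto intro: measurable_restrict_mono)
  obtain C where "AE t in lebesgue_on {a..b}. \<bar>f t\<bar> \<le> C"
    using assms compact_Icc unfolding Linf_loc_def by blast
  then have "integrable (lebesgue_on {a..b}) f"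
    using f by (intro finite_measure.integrable_const_bound finite_measure_lebesgue_on) auto
  then show ?thesis
    by (simp add: set_integrable_def integrable_restrict_space)
qed

lemma Linf_loc_integrable_on:
  assumes "Linf_loc S f" "{a..b} \<subseteq> S"
  shows "f integrable_on {a..b}"
  using Linf_loc_absolutely_integrable[OF assms] absolutely_integrable_on_def by blast

section \<open>Comparison of integrals and integrability at infinity\<close>

text \<open>Replacing \<open>g\<close> by \<open>f\<close> on \<open>N\<close> keeps the integral
  and makes the inequality hold everywhere.\<close>

lemma integral_le_negligible:
  fixes f g :: "real \<Rightarrow> real"
  assumes "f integrable_on S" "g integrable_on S" "negligible N" "\<And>x. x \<in> S - N \<Longrightarrow> f x \<le> g x"
  shows "integral S f \<le> integral S g"
proof -
  define h where "h x = (if x \<in> N then f x else g x)" for x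
  have "(h has_integral integral S g) S"
    by (rule has_integral_spike[OF assms(3) _ integrable_integral[OF assms(2)]]) (simp add: h_def)
  then show ?thesis
    using assms(4) by (intro has_integral_le[OF integrable_integral[OF assms(1)]]) (auto simp: h_def)
qed

text \<open>Monotone convergence along the truncations of \<open>f\<close> to
  \<open>{a..a + real n}\<close>, whose integrals increase and stay below \<open>B\<close>.\<close>

lemma nonneg_integrable_at_infinity:
  assumes f: "Linf_loc {a..} f" and N: "negligible N" and nonneg: "\<And>t. t \<ge> a \<Longrightarrow> t \<notin> N \<Longrightarrow> 0 \<le> f t"
    and bound: "\<And>t. t \<ge> a \<Longrightarrow> integral {a..t} f \<le> B"
  shows "set_integrable lebesgue {a..} f" "(LINT t:{a..}|lebesgue. f t) \<le> B"
proof -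
  define F where "F = (\<lambda>n t. indicator {a..a + real n} t *\<^sub>R f t)"
  have AE: "AE t in lebesgue. t \<notin> N"
    using N by (simp add: negligible_iff_null_sets AE_not_in)
  have int: "integrable lebesgue (F n)" for n
    using Linf_loc_absolutely_integrable[OF f, of a "a + real n"] by (simp add: F_def set_integrable_def)
  have eq: "integral\<^sup>L lebesgue (F n) = integral {a..a + real n} f" for n
    using set_lebesgue_integral_eq_integral(2)[OF Linf_loc_absolutely_integrable[OF f, of a "a + real n"]]
    by (simp add: F_def set_lebesgue_integral_def)
  have Fmono: "AE t in lebesgue. mono (\<lambda>n. F n t)"
    using AE by eventually_elim (auto simp: F_def mono_def indicator_def nonneg)
  have Fpos: "AE t in lebesgue. 0 \<le> F n t" for n
    using AE by eventually_elim (auto simp: F_def indicator_def nonneg)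
  have Flim: "AE t in lebesgue. (\<lambda>n. F n t) \<longlonglongrightarrow> indicator {a..} t *\<^sub>R f t"
  proof (intro AE_I2 tendsto_eventually)
    fix t
    obtain n0 where "t - a \<le> real n0" using real_arch_simple by blast
    then have "F n t = indicator {a..} t *\<^sub>R f t" if "n \<ge> n0" for n
      using that by (auto simp: F_def indicator_def)
    then show "\<forall>\<^sub>F n in sequentially. F n t = indicator {a..} t *\<^sub>R f t"
      by (auto simp: eventually_sequentially)
  qed
  have "incseq (\<lambda>n. integral\<^sup>L lebesgue (F n))"
    unfolding mono_def
  proof (intro allI impI integral_mono_AE int)
    show "AE t in lebesgue. F m t \<le> F n t" if "m \<le> n" for m n
      using Fmono by eventually_elim (use that in \<open>auto simp: mono_def\<close>)
  qed
  moreover have le: "integral\<^sup>L lebesgue (F n) \<le> B" for n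
    using bound[of "a + real n"] by (simp add: eq)
  ultimately obtain L where L: "(\<lambda>n. integral\<^sup>L lebesgue (F n)) \<longlonglongrightarrow> L"
    using incseq_convergent[of _ B] by metis
  have u: "(\<lambda>t. indicator {a..} t *\<^sub>R f t) \<in> borel_measurable lebesgue"
    using f unfolding Linf_loc_def by (simp add: borel_measurable_restrict_space_iff)
  note conv = integral_monotone_convergence_nonneg[OF int Fmono Fpos Flim L u]
  show "set_integrable lebesgue {a..} f" using conv(1) by (simp add: set_integrable_def)
  have "L \<le> B" using L le by (intro LIMSEQ_le_const2) auto
  then show "(LINT t:{a..}|lebesgue. f t) \<le> B" using conv(2) by (simp add: set_lebesgue_integral_def)
qed

text \<open>Difference quotients are at most \<open>K * \<bar>y - x\<bar>\<close>, so the derivative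
  vanishes at every point of the interval.\<close>

lemma quadratic_modulus_imp_constant:
  fixes f :: "real \<Rightarrow> real"
  assumes "a \<le> b" and bound: "\<And>x y. a \<le> x \<Longrightarrow> x \<le> y \<Longrightarrow> y \<le> b \<Longrightarrow> \<bar>f y - f x\<bar> \<le> K * (y - x)\<^sup>2"
  shows "f a = f b"
proof -
  have bound': "\<bar>f y - f x\<bar> \<le> K * (y - x)\<^sup>2" if "x \<in> {a..b}" "y \<in> {a..b}" for x y
    using bound[of x y] bound[of y x] that by (cases "x \<le> y") (auto simp: abs_minus_commute power2_commute)
  have "(f has_derivative (\<lambda>h. 0)) (at x within {a..b})" if x: "x \<in> {a..b}" for x
    unfolding has_derivative_within_alt
  proof (intro conjI allI impI)
    fix e :: real assume "e > 0"
    define d where "d = e / (\<bar>K\<bar> + 1)"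
    have "d > 0" using \<open>e > 0\<close> by (simp add: d_def)
    moreover have "norm (f y - f x - 0) \<le> e * norm (y - x)" if y: "y \<in> {a..b}" "norm (y - x) < d" for y
    proof -
      have "\<bar>f y - f x\<bar> \<le> (\<bar>K\<bar> + 1) * (y - x)\<^sup>2"
        using bound'[OF x y(1)] mult_right_mono[of K "\<bar>K\<bar> + 1" "(y - x)\<^sup>2"] by fastforce
      also have "\<dots> = ((\<bar>K\<bar> + 1) * \<bar>y - x\<bar>) * \<bar>y - x\<bar>"
        by (simp add: power2_eq_square)
      also have "\<dots> \<le> e * \<bar>y - x\<bar>"
      proof (rule mult_right_mono)
        show "(\<bar>K\<bar> + 1) * \<bar>y - x\<bar> \<le> e"
          using y(2) by (simp add: d_def field_simps)
      qed simp
      finally show ?thesis by simp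
    qed
    ultimately show "\<exists>d>0. \<forall>y\<in>{a..b}. norm (y - x) < d \<longrightarrow> norm (f y - f x - 0) \<le> e * norm (y - x)"
      by blast
  qed simp
  then obtain c where "\<forall>x\<in>{a..b}. f x = c"
    using has_derivative_zero_constant[of "{a..b}" f] by auto
  with assms(1) show ?thesis by simp
qed

text \<open>
  Here \<open>r' = - f\<close> almost everywhere, but Lebesgue's differentiation theorem is avoided: the difference
  of the two sides over \<open>[s, t]\<close> is at most a multiple of \<open>(t - s)\<^sup>2\<close>.
\<close>
lemma integral_log_tail:
  fixes f r :: "real \<Rightarrow> real"
  assumes "a \<le> b" and f: "Linf_loc {a..b} f" and N: "negligible N"
    and nonneg: "\<And>t. t \<in> {a..b} - N \<Longrightarrow> 0 \<le> f t"
    and r: "\<And>s t. a \<le> s \<Longrightarrow> s \<le> t \<Longrightarrow> t \<le> b \<Longrightarrow> r s - r t = integral {s..t} f"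
    and pos: "r b > 0"
  shows "Linf_loc {a..b} (\<lambda>t. f t / r t)" (is ?I)
    and "integral {a..b} (\<lambda>t. f t / r t) = ln (r a) - ln (r b)" (is ?E)
proof -
  have fint: "f integrable_on {s..t}" if "a \<le> s" "t \<le> b" for s t
    using that by (intro Linf_loc_integrable_on[OF f]) auto
  obtain C0 where "AE t in lebesgue_on {a..b}. \<bar>f t\<bar> \<le> C0"
    using f unfolding Linf_loc_def by blast
  then obtain N' where N': "negligible N'" "\<And>t. t \<in> {a..b} - N' \<Longrightarrow> \<bar>f t\<bar> \<le> C0"
    using AE_lebesgue_on_iff_negligible[of "{a..b}" "\<lambda>t. \<bar>f t\<bar> \<le> C0"] by auto
  have diff: "0 \<le> r s - r t" "r s - r t \<le> C0 * (t - s)" if "a \<le> s" "s \<le> t" "t \<le> b" for s t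
  proof -
    have "integral {s..t} (\<lambda>_. 0) \<le> integral {s..t} f"
      using that nonneg by (intro integral_le_negligible[OF _ _ N] fint) auto
    then show "0 \<le> r s - r t" using r that by simp
    have "integral {s..t} f \<le> integral {s..t} (\<lambda>_. C0)"
      using that N'(2) by (intro integral_le_negligible[OF _ _ N'(1)] fint) (auto simp: abs_le_iff)
    then show "r s - r t \<le> C0 * (t - s)" using r that by (simp add: mult.commute)
  qed
  have rpos: "r t \<ge> r b" "r t > 0" if "a \<le> t" "t \<le> b" for t
    using diff(1)[of t b] that pos by auto
  have "continuous_on {a..b} r"
  proof (rule lipschitz_on_continuous_on)
    show "\<bar>C0\<bar>-lipschitz_on {a..b} r"
    proof (rule lipschitz_onI)
      fix x y assume xy: "x \<in> {a..b}" "y \<in> {a..b}"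
      have *: "\<bar>r s - r t\<bar> \<le> \<bar>C0\<bar> * \<bar>s - t\<bar>" if "a \<le> s" "s \<le> t" "t \<le> b" for s t
        using diff[OF that] that mult_right_mono[OF abs_ge_self[of C0], of "t - s"] by simp
      show "dist (r x) (r y) \<le> \<bar>C0\<bar> * dist x y"
        using *[of x y] *[of y x] xy by (cases "x \<le> y") (auto simp: dist_real_def abs_minus_commute)
    qed simp
  qed
  then have "continuous_on {a..b} (\<lambda>t. 1 / r t)"
    using rpos(2) by (intro continuous_intros) force+
  then have "Linf_loc {a..b} (\<lambda>t. 1 / r t)"
    by (intro continuous_on_imp_Linf_loc) auto
  from Linf_loc_mult[OF f this] show ?I by simp
  then have gint: "(\<lambda>t. f t / r t) integrable_on {s..t}" if "a \<le> s" "t \<le> b" for s t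
    using that by (intro Linf_loc_integrable_on) auto
  \<comment> \<open>The second claim says that \<open>G a = G b\<close>.\<close>
  define G where "G t = integral {a..t} (\<lambda>t. f t / r t) + ln (r t)" for t
  have "\<bar>G t - G s\<bar> \<le> (C0\<^sup>2 / (r b)\<^sup>2) * (t - s)\<^sup>2" if st: "a \<le> s" "s \<le> t" "t \<le> b" for s t
  proof -
    let ?I = "integral {s..t} (\<lambda>t. f t / r t)"
    have rs: "r s > 0" "r t > 0" "r t \<le> r s" using rpos diff(1)[OF st] st by auto
    \<comment> \<open>Since \<open>r\<close> is nonincreasing, \<open>?I\<close> lies between
      \<open>(r s - r t) / r s\<close> and \<open>(r s - r t) / r t\<close>. The bound
      \<open>ln x \<le> x - 1\<close> puts \<open>ln (r s) - ln (r t)\<close> between the same two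
      numbers, whose distance is quadratic in \<open>r s - r t\<close>.\<close>
    have "integral {s..t} (\<lambda>u. f u / r s) \<le> ?I"
    proof (rule integral_le_negligible[OF _ gint N])
      fix u assume "u \<in> {s..t} - N"
      then show "f u / r s \<le> f u / r u"
        using st nonneg[of u] diff(1)[of s u] rpos(2)[of u] by (intro divide_left_mono) auto
    qed (use st fint in \<open>auto intro: integrable_on_divide\<close>)
    then have I1: "(r s - r t) / r s \<le> ?I" using r st by simp
    have "?I \<le> integral {s..t} (\<lambda>u. f u / r t)"
    proof (rule integral_le_negligible[OF gint _ N])
      fix u assume "u \<in> {s..t} - N"
      then show "f u / r u \<le> f u / r t"
        using st nonneg[of u] diff(1)[of u t] rpos(2)[of u] rs by (intro divide_left_mono) auto
    qed (use st fint in \<open>auto intro: integrable_on_divide\<close>)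
    then have I2: "?I \<le> (r s - r t) / r t" using r st by simp
    have l1: "ln (r s) - ln (r t) \<le> (r s - r t) / r t"
      using ln_le_minus_one[of "r s / r t"] rs by (simp add: ln_div diff_divide_distrib)
    have l2: "(r s - r t) / r s \<le> ln (r s) - ln (r t)"
      using ln_le_minus_one[of "r t / r s"] rs by (simp add: ln_div diff_divide_distrib)
    have "G t - G s = ?I - (ln (r s) - ln (r t))"
      using Henstock_Kurzweil_Integration.integral_combine[of a s t "\<lambda>t. f t / r t"] st gint unfolding G_def by force
    then have "\<bar>G t - G s\<bar> \<le> (r s - r t) / r t - (r s - r t) / r s"
      using I1 I2 l1 l2 by linarith
    also have "\<dots> = (r s - r t)\<^sup>2 / (r s * r t)"
      using rs by (simp add: field_simps power2_eq_square)
    also have "\<dots> \<le> (C0 * (t - s))\<^sup>2 / (r b * r b)"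
      using diff[OF st] rpos[of s] rpos[of t] st pos by (intro frac_le power_mono mult_mono) auto
    also have "\<dots> = (C0\<^sup>2 / (r b)\<^sup>2) * (t - s)\<^sup>2"
      by (simp add: power2_eq_square mult_ac)
    finally show ?thesis .
  qed
  then have "G a = G b"
    by (rule quadratic_modulus_imp_constant[OF assms(1)])
  then show ?E unfolding G_def by simp
qed

subsection \<open>The Riccati equation\<close>

text \<open>Local boundedness fills the gap between \<open>t\<close> and the unknown
  \<open>R\<close>; \<open>max R t\<close> also covers \<open>R < t\<close>.\<close>

lemma set_integrable_at_infinity:
  assumes f: "Linf_loc {t0..} f" and L1: "L1_at_infinity f" and t: "t0 \<le> t"
  shows "set_integrable lebesgue {t..} f"
proof -
  obtain R where R: "set_integrable lebesgue {R..} f"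
    using L1 unfolding L1_at_infinity_def by blast
  have "set_integrable lebesgue ({t..max R t} \<union> {max R t..}) f"
    using t by (intro set_integrable_Un set_integrable_subset[OF R] Linf_loc_absolutely_integrable[OF f]) auto
  also have "{t..max R t} \<union> {max R t..} = {t..}" by auto
  finally show ?thesis .
qed

text \<open>One negligible set \<open>N\<close> carries all exceptions, so it can later absorb those
  of the solution too.\<close>

locale sturm_coefficients =
  fixes t0 :: real and A v :: "real \<Rightarrow> real" and N :: "real set"
  assumes A_Linf: "Linf_loc {t0..} A"
    and v_Linf: "Linf_loc {t0..} v"
    and inv_Linf: "Linf_loc {t0..} (\<lambda>t. 1 / v t)"
    and N: "negligible N"
    and A_nonneg: "t0 \<le> t \<Longrightarrow> t \<notin> N \<Longrightarrow> 0 \<le> A t"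
    and v_pos: "t0 \<le> t \<Longrightarrow> t \<notin> N \<Longrightarrow> 0 < v t"
begin

lemma integrable_A_v: "t0 \<le> s \<Longrightarrow> (\<lambda>t. A t * v t) integrable_on {s..t}"
  by (rule Linf_loc_integrable_on[OF Linf_loc_mult[OF A_Linf v_Linf]]) auto

lemma integrable_inv: "t0 \<le> s \<Longrightarrow> (\<lambda>t. 1 / v t) integrable_on {s..t}"
  by (rule Linf_loc_integrable_on[OF inv_Linf]) auto

lemma integrable_sqrt: "t0 \<le> s \<Longrightarrow> (\<lambda>t. sqrt (A t)) integrable_on {s..t}"
  by (rule Linf_loc_integrable_on[OF Linf_loc_sqrt[OF A_Linf]]) auto

text \<open>The integral inside \<open>chi\<close>, called \<open>r\<close> in the outline.\<close>

definition tail :: "real \<Rightarrow> real" where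
  "tail t = (LINT s:{t..}|lebesgue. 1 / v s)"

context
  assumes L1: "L1_at_infinity (\<lambda>t. 1 / v t)"
begin

lemma tail_eq_integral: "t0 \<le> t \<Longrightarrow> tail t = integral {t..} (\<lambda>s. 1 / v s)"
  "t0 \<le> t \<Longrightarrow> (\<lambda>s. 1 / v s) integrable_on {t..}"
  using set_lebesgue_integral_eq_integral[OF set_integrable_at_infinity[OF inv_Linf L1]]
  by (auto simp: tail_def)

lemma tail_diff:
  assumes "t0 \<le> s" "s \<le> t"
  shows "tail s - tail t = integral {s..t} (\<lambda>u. 1 / v u)"
proof -
  have "((\<lambda>u. 1 / v u) has_integral (integral {s..t} (\<lambda>u. 1 / v u) + tail t)) ({s..t} \<union> {t..})"
  proof (rule has_integral_Un)
    show "((\<lambda>u. 1 / v u) has_integral integral {s..t} (\<lambda>u. 1 / v u)) {s..t}"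
      using integrable_inv assms by blast
    show "((\<lambda>u. 1 / v u) has_integral tail t) {t..}"
      using tail_eq_integral[of t] assms by (simp add: integrable_integral)
    have "{s..t} \<inter> {t..} \<subseteq> {t}" by auto
    then show "negligible ({s..t} \<inter> {t..})"
      using negligible_sing negligible_subset by blast
  qed
  also have "{s..t} \<union> {t..} = {s..}" using assms by auto
  finally show ?thesis using tail_eq_integral(1)[of s] assms by (simp add: integral_unique)
qed

text \<open>An essential bound for \<open>v\<close> on \<open>{t..t + 1}\<close> gives
  \<open>1 / v\<close> a positive lower bound there, so the tail strictly drops across this
  interval; the remaining tail is nonnegative.\<close>

lemma tail_pos:
  assumes t: "t0 \<le> t"
  shows "0 < tail t"
proof -
  have "compact {t..t + 1}" "{t..t + 1} \<subseteq> {t0..}" using t by auto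
  then obtain C where "AE s in lebesgue_on {t..t + 1}. \<bar>v s\<bar> \<le> C"
    using v_Linf unfolding Linf_loc_def by blast
  then obtain M where M: "negligible M" "\<And>s. s \<in> {t..t + 1} - M \<Longrightarrow> \<bar>v s\<bar> \<le> C"
    using AE_lebesgue_on_iff_negligible[of "{t..t + 1}" "\<lambda>s. \<bar>v s\<bar> \<le> C"] by auto
  \<comment> \<open>Dividing by \<open>D\<close> is safe whatever the sign of
    \<open>C\<close>.\<close>
  define D where "D = \<bar>C\<bar> + 1"
  have "integral {t..t + 1} (\<lambda>_. 1 / D) \<le> integral {t..t + 1} (\<lambda>s. 1 / v s)"
  proof (rule integral_le_negligible[OF _ integrable_inv])
    show "negligible (M \<union> N)" using M(1) N by (rule negligible_Un)
    fix s assume s: "s \<in> {t..t + 1} - (M \<union> N)"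
    then have "0 < v s" "v s \<le> D" using M(2)[of s] v_pos[of s] t by (auto simp: D_def)
    then show "1 / D \<le> 1 / v s" by (intro divide_left_mono) auto
  qed (use t in auto)
  then have "1 / D \<le> integral {t..t + 1} (\<lambda>s. 1 / v s)" by simp
  moreover have "0 < 1 / D" by (simp add: D_def)
  moreover have "tail t - tail (t + 1) = integral {t..t + 1} (\<lambda>s. 1 / v s)"
    using tail_diff[of t "t + 1"] t by simp
  ultimately have "tail (t + 1) < tail t" by linarith
  moreover have "0 \<le> tail (t + 1)"
  proof -
    have "integral {t + 1..} (\<lambda>_. 0) \<le> integral {t + 1..} (\<lambda>s. 1 / v s)"
    proof (rule integral_le_negligible[OF _ tail_eq_integral(2) N])
      show "0 \<le> 1 / v s" if "s \<in> {t + 1..} - N" for s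
        using v_pos[of s] that t by simp
    qed (use t in \<open>auto intro: integrable_0\<close>)
    then show ?thesis using tail_eq_integral(1)[of "t + 1"] t by simp
  qed
  ultimately show ?thesis by linarith
qed

lemma sqrt_chi:
  assumes "t0 \<le> t" "t \<notin> N"
  shows "sqrt (chi v t) = (1 / v t / tail t) / 2"
proof -
  have "0 < 2 * v t * tail t" using assms v_pos tail_pos by simp
  then have "sqrt ((2 * v t * tail t) powi (-2)) = inverse (2 * v t * tail t)"
    by (simp add: power_int_minus real_sqrt_inverse power_int_numeral_neg_numeral)
  then show ?thesis by (simp add: chi_def tail_def field_simps)
qed

text \<open>Off \<open>N\<close> the integrand is half of \<open>(1 / v) / tail\<close>, a
  logarithmic derivative up to sign, so \<open>integral_log_tail\<close> applies with
  \<open>1 / v\<close> as \<open>f\<close> and \<open>tail\<close> as \<open>r\<close>.\<close>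

lemma sqrt_chi_integral:
  assumes "t0 \<le> s" "s \<le> t"
  shows "(\<lambda>u. sqrt (chi v u)) absolutely_integrable_on {s..t}"
    and "integral {s..t} (\<lambda>u. sqrt (chi v u)) = (ln (tail s) - ln (tail t)) / 2"
proof -
  have inv: "Linf_loc {s..t} (\<lambda>u. 1 / v u)"
    using assms by (intro Linf_loc_subset[OF inv_Linf]) auto
  have pos: "0 \<le> 1 / v u" if "u \<in> {s..t} - N" for u
    using v_pos[of u] that assms by auto
  have diff: "tail p - tail q = integral {p..q} (\<lambda>u. 1 / v u)" if "s \<le> p" "p \<le> q" "q \<le> t" for p q
    using tail_diff that assms by auto
  have "tail t > 0" using tail_pos assms by auto
  note log = integral_log_tail[OF assms(2) inv N pos diff this]
  have half: "(\<lambda>u. (1 / v u / tail u) / 2) absolutely_integrable_on {s..t}"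
    by (intro set_integrable_divide Linf_loc_absolutely_integrable[OF log(1)]) auto
  have eq: "sqrt (chi v u) = (1 / v u / tail u) / 2" if "u \<in> {s..t} - N" for u
    using sqrt_chi that assms by auto
  show "(\<lambda>u. sqrt (chi v u)) absolutely_integrable_on {s..t}"
    using half by (rule absolutely_integrable_spike[OF _ N]) (use eq in auto)
  have "integral {s..t} (\<lambda>u. sqrt (chi v u)) = integral {s..t} (\<lambda>u. (1 / v u / tail u) / 2)"
    by (rule integral_spike[OF N]) (use eq in auto)
  then show "integral {s..t} (\<lambda>u. sqrt (chi v u)) = (ln (tail s) - ln (tail t)) / 2"
    by (simp only: integral_divide log(2))
qed

end

end

section \<open>Integral estimates from the Riccati equation\<close>

text \<open>Here \<open>y\<close> stands for \<open>- v z' / z\<close>; its absolute continuity and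
  its equation off \<open>N\<close> are all that the estimates take from the solution.\<close>

locale riccati = sturm_coefficients +
  fixes a :: real and y :: "real \<Rightarrow> real"
  assumes a: "t0 \<le> a"
    and ac: "a \<le> s \<Longrightarrow> abs_continuous_on {s..t} y"
    and riccati: "a \<le> t \<Longrightarrow> t \<notin> N \<Longrightarrow>
      (y has_real_derivative A t * v t + (y t)\<^sup>2 / v t) (at t)"
begin

text \<open>Drop the nonnegative term \<open>(y t)\<^sup>2 / v t\<close> from the equation.\<close>

lemma integral_A_v_le:
  assumes "a \<le> s" "s \<le> t"
  shows "integral {s..t} (\<lambda>t. A t * v t) \<le> y t - y s"
proof (rule abs_continuous_on_integral_le[OF assms(2) ac N])
  fix x assume "x \<in> {s..t} - N"
  then have x: "a \<le> x" "x \<notin> N" using assms by auto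
  then show "\<exists>d. (y has_real_derivative d) (at x) \<and> A x * v x \<le> d"
    using riccati[OF x] v_pos[of x] a by (intro exI[of _ "A x * v x + (y x)\<^sup>2 / v x"]) auto
qed (use assms a in \<open>auto intro: integrable_A_v\<close>)

lemma y_mono:
  assumes "a \<le> s" "s \<le> t"
  shows "y s \<le> y t"
proof -
  have "integral {s..t} (\<lambda>_. 0) \<le> integral {s..t} (\<lambda>t. A t * v t)"
  proof (rule integral_le_negligible[OF _ integrable_A_v N])
    fix x assume "x \<in> {s..t} - N"
    then show "0 \<le> A x * v x" using A_nonneg[of x] v_pos[of x] assms a by simp
  qed (use assms a in auto)
  then show ?thesis using integral_A_v_le[OF assms] by simp
qed

text \<open>Dividing the equation by \<open>y\<^sup>2\<close> shows that \<open>- 1 / y\<close>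
  grows at least at rate \<open>1 / v\<close>, while it never exceeds 0. The bound does not depend
  on \<open>t\<close>, as integrability at infinity requires.\<close>

lemma integral_inv_le:
  assumes "a \<le> s" "s \<le> t" and pos: "0 < y s"
  shows "integral {s..t} (\<lambda>t. 1 / v t) \<le> 1 / y s"
proof -
  have y: "y s \<le> y u" "0 < y u" if "u \<in> {s..t}" for u
    using y_mono[of s u] that assms by auto
  have "integral {s..t} (\<lambda>t. 1 / v t) \<le> - (1 / y t) - - (1 / y s)"
  proof (rule abs_continuous_on_integral_le[OF assms(2) _ N])
    \<comment> \<open>By monotonicity \<open>y\<close> stays above \<open>y s > 0\<close>, where the
      reciprocal is Lipschitz.\<close>
    show "abs_continuous_on {s..t} (\<lambda>u. - (1 / y u))"
    proof (rule abs_continuous_on_dominated[OF ac ac])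
      fix p q assume pq: "p \<in> {s..t}" "q \<in> {s..t}"
      have "\<bar>- (1 / y q) - - (1 / y p)\<bar> = \<bar>y q - y p\<bar> / (y p * y q)"
        using y(2)[OF pq(1)] y(2)[OF pq(2)] by (simp add: field_simps abs_divide flip: abs_mult)
      also have "\<dots> \<le> \<bar>y q - y p\<bar> / (y s * y s)"
        using y(1)[OF pq(1)] y(1)[OF pq(2)] pos by (intro divide_left_mono mult_mono mult_pos_pos) auto
      also have "\<dots> \<le> 1 / (y s * y s) * \<bar>y q - y p\<bar> + 1 / (y s * y s) * \<bar>y q - y p\<bar>"
        using pos by (simp add: divide_right_mono)
      finally show "\<bar>- (1 / y q) - - (1 / y p)\<bar>
          \<le> 1 / (y s * y s) * \<bar>y q - y p\<bar> + 1 / (y s * y s) * \<bar>y q - y p\<bar>" .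
    qed (use assms in auto)
    fix x assume x: "x \<in> {s..t} - N"
    then have ax: "a \<le> x" "x \<notin> N" using assms by auto
    have yx: "0 < y x" using y x by auto
    have "((\<lambda>u. - (1 / y u)) has_real_derivative (A x * v x + (y x)\<^sup>2 / v x) / (y x)\<^sup>2) (at x)"
    proof -
      have "((\<lambda>u. - (1 / y u)) has_real_derivative d / (y x)\<^sup>2) (at x)"
        if "(y has_real_derivative d) (at x)" for d
        using DERIV_minus[OF DERIV_divide[OF DERIV_const[of 1] that]] yx
        by (simp add: power2_eq_square)
      then show ?thesis using riccati[OF ax] .
    qed
    moreover have "1 / v x \<le> (A x * v x + (y x)\<^sup>2 / v x) / (y x)\<^sup>2"
      using yx v_pos[of x] A_nonneg[of x] ax a by (simp add: add_divide_distrib)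
    ultimately show "\<exists>d. ((\<lambda>u. - (1 / y u)) has_real_derivative d) (at x) \<and> 1 / v x \<le> d"
      by blast
  qed (use assms a in \<open>auto intro: integrable_inv\<close>)
  moreover have "0 < 1 / y t" using y(2)[of t] assms by simp
  ultimately show ?thesis by linarith
qed

lemma integral_sqrt_le:
  assumes "a \<le> s" "s \<le> t" and pos: "0 < y s"
  shows "integral {s..t} (\<lambda>t. sqrt (A t)) \<le> (ln (y t) - ln (y s)) / 2"
proof -
  have y: "y s \<le> y u" "0 < y u" if "u \<in> {s..t}" for u
    using y_mono[of s u] that assms by auto
  \<comment> \<open>The points are not ordered, so exchanging them later yields the bound for the
    absolute value.\<close>
  have lnle: "ln (y q) - ln (y p) \<le> \<bar>y q - y p\<bar> / y s" if pq: "p \<in> {s..t}" "q \<in> {s..t}" for p q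
  proof -
    have "ln (y q) - ln (y p) \<le> (y q - y p) / y p"
      using ln_le_minus_one[of "y q / y p"] y(2)[OF pq(1)] y(2)[OF pq(2)] by (simp add: ln_div diff_divide_distrib)
    also have "\<dots> \<le> \<bar>y q - y p\<bar> / y s"
      using y(1)[OF pq(1)] pos by (intro frac_le) auto
    finally show ?thesis .
  qed
  have "integral {s..t} (\<lambda>t. 2 * sqrt (A t)) \<le> ln (y t) - ln (y s)"
  proof (rule abs_continuous_on_integral_le[OF assms(2) _ N])
    show "abs_continuous_on {s..t} (\<lambda>u. ln (y u))"
    proof (rule abs_continuous_on_dominated[OF ac ac])
      fix p q assume pq: "p \<in> {s..t}" "q \<in> {s..t}"
      have "\<bar>ln (y q) - ln (y p)\<bar> \<le> \<bar>y q - y p\<bar> / y s"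
        using lnle[OF pq] lnle[OF pq(2,1)] by (simp add: abs_le_iff abs_minus_commute)
      also have "\<dots> \<le> 1 / y s * \<bar>y q - y p\<bar> + 1 / y s * \<bar>y q - y p\<bar>"
        using pos by (simp add: divide_right_mono)
      finally show "\<bar>ln (y q) - ln (y p)\<bar> \<le> 1 / y s * \<bar>y q - y p\<bar> + 1 / y s * \<bar>y q - y p\<bar>" .
    qed (use assms in auto)
    fix x assume x: "x \<in> {s..t} - N"
    then have ax: "a \<le> x" "x \<notin> N" using assms by auto
    have yx: "0 < y x" using y x by auto
    have vA: "0 < v x" "0 \<le> A x" using v_pos[of x] A_nonneg[of x] ax a by auto
    have "((\<lambda>u. ln (y u)) has_real_derivative (A x * v x + (y x)\<^sup>2 / v x) / y x) (at x)"
      using yx by (auto intro!: derivative_eq_intros riccati[OF ax])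
    moreover have "2 * sqrt (A x) \<le> (A x * v x + (y x)\<^sup>2 / v x) / y x"
    proof -
      \<comment> \<open>The arithmetic-geometric mean inequality for \<open>A v / y\<close> and
        \<open>y / v\<close>, multiplied by \<open>v y\<close>.\<close>
      have "0 \<le> (sqrt (A x) * v x - y x)\<^sup>2" by simp
      also have "\<dots> = A x * (v x)\<^sup>2 + (y x)\<^sup>2 - 2 * sqrt (A x) * v x * y x"
        using vA by (simp add: power2_diff power_mult_distrib)
      finally show ?thesis
        using yx vA by (simp add: field_simps power2_eq_square)
    qed
    ultimately show "\<exists>d. ((\<lambda>u. ln (y u)) has_real_derivative d) (at x) \<and> 2 * sqrt (A x) \<le> d"
      by blast
  qed (use assms a in \<open>auto intro!: integrable_sqrt integrable_on_cmult_left\<close>)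
  then show ?thesis by simp
qed

text \<open>Let \<open>t\<close> tend to infinity in \<open>integral_inv_le\<close>. The tail bound
  is available at each later point too, since \<open>y\<close> stays positive.\<close>

lemma inv_integrable_at_infinity:
  assumes s: "a \<le> s" and pos: "0 < y s"
  shows "set_integrable lebesgue {s..} (\<lambda>t. 1 / v t)" "tail s \<le> 1 / y s"
proof -
  have *: "Linf_loc {s..} (\<lambda>t. 1 / v t)" "\<And>t. s \<le> t \<Longrightarrow> t \<notin> N \<Longrightarrow> 0 \<le> 1 / v t"
    using s a v_pos by (auto intro: Linf_loc_subset[OF inv_Linf] simp: less_imp_le)
  from nonneg_integrable_at_infinity[OF *(1) N *(2) integral_inv_le[OF s _ pos]]
  show "set_integrable lebesgue {s..} (\<lambda>t. 1 / v t)" "tail s \<le> 1 / y s"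
    by (auto simp: tail_def)
qed

text \<open>Contradicts the first alternative of the hypothesis. If \<open>y\<close> is never
  positive, \<open>y t - y a \<le> - y a\<close> bounds the integrals of \<open>A v\<close>.\<close>

lemma L1_alternative: "L1_at_infinity (\<lambda>t. 1 / v t) \<or> L1_at_infinity (\<lambda>t. A t * v t)"
proof (cases "\<exists>s\<ge>a. 0 < y s")
  case True
  then show ?thesis
    using inv_integrable_at_infinity(1) unfolding L1_at_infinity_def by blast
next
  case False
  have "set_integrable lebesgue {a..} (\<lambda>t. A t * v t)"
  proof (rule nonneg_integrable_at_infinity[OF _ N])
    show "Linf_loc {a..} (\<lambda>t. A t * v t)"
      using a by (intro Linf_loc_subset[OF Linf_loc_mult[OF A_Linf v_Linf]]) auto
    show "0 \<le> A t * v t" if "a \<le> t" "t \<notin> N" for t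
      using that a A_nonneg[of t] v_pos[of t] by simp
    show "integral {a..t} (\<lambda>t. A t * v t) \<le> - y a" if "a \<le> t" for t
      using integral_A_v_le[of a t] that False by force
  qed
  then show ?thesis unfolding L1_at_infinity_def by blast
qed

text \<open>Contradicts the second alternative. The starting point \<open>s\<close> has to be
  movable, because \<open>ln (y s)\<close> enters the bound only once \<open>y\<close> is
  positive.\<close>

lemma sqrt_integral_bounded:
  assumes L1: "L1_at_infinity (\<lambda>t. 1 / v t)"
  shows "\<exists>s\<ge>a. \<exists>K. \<forall>t\<ge>s. integral {s..t} (\<lambda>u. sqrt (A u)) - integral {s..t} (\<lambda>u. sqrt (chi v u)) \<le> K"
proof (cases "\<exists>s\<ge>a. 0 < y s")
  case True
  then obtain s where s: "a \<le> s" "0 < y s" by blast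
  \<comment> \<open>The two integral formulas leave half of \<open>ln (y t) + ln (tail t)\<close>
    minus its value at \<open>s\<close>, and \<open>y t * tail t \<le> 1\<close>.\<close>
  have "integral {s..t} (\<lambda>u. sqrt (A u)) - integral {s..t} (\<lambda>u. sqrt (chi v u))
      \<le> - (ln (y s) + ln (tail s)) / 2" if t: "s \<le> t" for t
  proof -
    have yt: "a \<le> t" "0 < y t" using y_mono[OF s(1) t] s t by auto
    have r: "0 < tail t" using tail_pos[OF L1, of t] a yt by auto
    have "tail t \<le> 1 / y t" using inv_integrable_at_infinity(2)[OF yt] .
    then have "ln (tail t) \<le> ln (1 / y t)" using r yt by simp
    then have "ln (y t) \<le> - ln (tail t)" using yt by (simp add: ln_div)
    then show ?thesis
      using integral_sqrt_le[OF s(1) t s(2)] sqrt_chi_integral(2)[OF L1 _ t] a s by simp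
  qed
  then show ?thesis using s(1) by blast
next
  case False
  have "integral {a..t} (\<lambda>u. sqrt (A u)) - integral {a..t} (\<lambda>u. sqrt (chi v u))
      \<le> (- y a + tail a) / 2" if t: "a \<le> t" for t
  proof -
    have "integral {a..t} (\<lambda>u. sqrt (A u)) \<le> integral {a..t} (\<lambda>u. (A u * v u + 1 / v u) / 2)"
    proof (rule integral_le_negligible[OF _ _ N])
      show "(\<lambda>u. (A u * v u + 1 / v u) / 2) integrable_on {a..t}"
        using a by (intro integrable_on_divide integrable_add integrable_A_v integrable_inv)
      fix u assume "u \<in> {a..t} - N"
      then have vA: "0 < v u" "0 \<le> A u" using v_pos[of u] A_nonneg[of u] a by auto
      \<comment> \<open>Dividing this square by \<open>2 * v u\<close> gives the mean
        inequality.\<close>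
      have "0 \<le> (sqrt (A u) * v u - 1)\<^sup>2" by simp
      also have "\<dots> = A u * (v u)\<^sup>2 + 1 - 2 * sqrt (A u) * v u"
        using vA by (simp add: power2_diff power_mult_distrib)
      finally show "sqrt (A u) \<le> (A u * v u + 1 / v u) / 2"
        using vA by (simp add: field_simps power2_eq_square)
    qed (use a in \<open>auto intro: integrable_sqrt\<close>)
    also have "\<dots> = (integral {a..t} (\<lambda>u. A u * v u) + integral {a..t} (\<lambda>u. 1 / v u)) / 2"
      using a by (simp add: Henstock_Kurzweil_Integration.integral_add integrable_A_v integrable_inv)
    also have "\<dots> \<le> (- y a + tail a) / 2"
      using integral_A_v_le[OF order_refl t] tail_diff[OF L1 a t] tail_pos[OF L1, of t] a t False by force
    finally have "integral {a..t} (\<lambda>u. sqrt (A u)) \<le> (- y a + tail a) / 2" .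
    moreover have "0 \<le> integral {a..t} (\<lambda>u. sqrt (chi v u))"
    proof -
      \<comment> \<open>The exponent is even, so this holds at every point, including those of
        \<open>N\<close>.\<close>
      have "0 \<le> chi v u" for u by (simp add: chi_def power_int_def)
      then show ?thesis by (intro Henstock_Kurzweil_Integration.integral_nonneg
          set_lebesgue_integral_eq_integral(1)[OF sqrt_chi_integral(1)[OF L1 a t]]) simp
    qed
    ultimately show ?thesis by linarith
  qed
  then show ?thesis by blast
qed

end

section \<open>From a nonvanishing solution to the contradiction\<close>

text \<open>The quotient rule gives the equation. Absolute continuity of \<open>w / z\<close>
  follows from that of \<open>w\<close>, the Lipschitz bound for \<open>z\<close>, and bounds for
  \<open>w\<close> and \<open>1 / z\<close> on compact intervals. The start is strictly beyond
  \<open>t0\<close> because \<open>w\<close> is controlled only on the open half-line.\<close>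

lemma solution_riccati:
  assumes sc: "sturm_coefficients t0 A v N" and lip: "Lip_loc {t0..} z" and a: "t0 < a"
    and nz: "\<And>t. a \<le> t \<Longrightarrow> z t \<noteq> 0"
    and w: "loc_abs_continuous_on {t0<..} w"
    and z': "\<And>t. a \<le> t \<Longrightarrow> t \<notin> N \<Longrightarrow> \<exists>z'. (z has_real_derivative z') (at t) \<and> w t = v t * z'"
    and w': "\<And>t. a \<le> t \<Longrightarrow> t \<notin> N \<Longrightarrow> (w has_real_derivative - (A t * v t * z t)) (at t)"
  shows "riccati t0 A v N a (\<lambda>t. - (w t / z t))"
proof -
  interpret sturm_coefficients t0 A v N by fact
  show ?thesis
  proof
    show "t0 \<le> a" using a by simp
    fix t assume t: "a \<le> t" "t \<notin> N"
    obtain d where d: "(z has_real_derivative d) (at t)" "w t = v t * d" using z'[OF t] by blast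
    have v: "v t > 0" using v_pos[of t] t a by auto
    \<comment> \<open>Substituting \<open>d = w t / v t\<close> turns the product
      \<open>w t * d\<close> into a square over \<open>v t\<close>.\<close>
    have "- ((- (A t * v t * z t) * z t - w t * d) / (z t * z t)) = A t * v t + (- (w t / z t))\<^sup>2 / v t"
      using v nz[OF t(1)] by (simp add: d(2) field_simps power2_eq_square)
    then show "((\<lambda>t. - (w t / z t)) has_real_derivative A t * v t + (- (w t / z t))\<^sup>2 / v t) (at t)"
      using DERIV_minus[OF DERIV_divide[OF w'[OF t] d(1) nz[OF t(1)]]] by simp
  next
    fix s t assume s: "a \<le> s"
    have sub: "{s..t} \<subseteq> {t0..}" "{s..t} \<subseteq> {t0<..}" using s a by auto
    have wac: "abs_continuous_on {s..t} w"
      using w sub(2) unfolding loc_abs_continuous_on_def by blast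
    obtain L where L: "L-lipschitz_on {s..t} z" using Lip_loc_imp_lipschitz_on[OF lip sub(1)] .
    have zcont: "continuous_on {s..t} z" using L by (rule lipschitz_on_continuous_on)
    have "continuous_on {s..t} (\<lambda>u. 1 / z u)"
      using nz s by (intro continuous_intros zcont) auto
    then have "bounded ((\<lambda>u. 1 / z u) ` {s..t})"
      using compact_continuous_image compact_imp_bounded by blast
    then obtain M where M: "M > 0" "\<And>u. u \<in> {s..t} \<Longrightarrow> \<bar>1 / z u\<bar> \<le> M"
      unfolding bounded_pos by auto
    have "bounded (w ` {s..t})"
      using abs_continuous_on_imp_continuous_on[OF wac] compact_continuous_image compact_imp_bounded by blast
    then obtain W where W: "W > 0" "\<And>u. u \<in> {s..t} \<Longrightarrow> \<bar>w u\<bar> \<le> W"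
      unfolding bounded_pos by auto
    have L0: "L \<ge> 0" "\<And>p q. p \<in> {s..t} \<Longrightarrow> q \<in> {s..t} \<Longrightarrow> \<bar>z p - z q\<bar> \<le> L * \<bar>p - q\<bar>"
      using L unfolding lipschitz_on_def dist_real_def by auto
    define C where "C = max M (W * L * M * M)"
    show "abs_continuous_on {s..t} (\<lambda>t. - (w t / z t))"
    proof (rule abs_continuous_on_dominated[OF wac abs_continuous_on_ident])
      fix p q assume pq: "p \<in> {s..t}" "q \<in> {s..t}"
      have nzpq: "z p \<noteq> 0" "z q \<noteq> 0" using nz pq s by auto
      \<comment> \<open>Adding and subtracting \<open>w p / z q\<close> separates the increment of
        \<open>w\<close> from that of \<open>z\<close>.\<close>
      have "- (w q / z q) - - (w p / z p) = - ((w q - w p) * (1 / z q) + w p * (z p - z q) * (1 / z p) * (1 / z q))"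
        using nzpq by (simp add: field_simps)
      then have "\<bar>- (w q / z q) - - (w p / z p)\<bar>
          \<le> \<bar>(w q - w p) * (1 / z q)\<bar> + \<bar>w p * (z p - z q) * (1 / z p) * (1 / z q)\<bar>"
        by (metis abs_minus_cancel abs_triangle_ineq)
      also have "\<dots> \<le> \<bar>w q - w p\<bar> * M + W * (L * \<bar>p - q\<bar>) * M * M"
        unfolding abs_mult
        using M(2)[OF pq(1)] M(2)[OF pq(2)] W(2)[OF pq(1)] L0(2)[OF pq] M(1) W(1) L0(1)
        by (intro add_mono mult_mono) auto
      also have "\<dots> = M * \<bar>w q - w p\<bar> + (W * L * M * M) * \<bar>q - p\<bar>"
        by (simp add: abs_minus_commute)
      also have "\<dots> \<le> C * \<bar>w q - w p\<bar> + C * \<bar>q - p\<bar>"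
        by (intro add_mono mult_right_mono) (auto simp: C_def)
      finally show "\<bar>- (w q / z q) - - (w p / z p)\<bar> \<le> C * \<bar>w q - w p\<bar> + C * \<bar>q - p\<bar>" .
    qed
  qed
qed

theorem corollary2p4:
  fixes t0 z0 :: real and A v z :: "real \<Rightarrow> real"
  assumes "0 < t0"
    and "Linf_loc {t0..} A"
    and "AE t in lebesgue_on {t0..}. 0 \<le> A t"
    and "\<not> (AE t in lebesgue_on {t0..}. A t = 0)"
    and "Linf_loc {t0..} v"
    and "AE t in lebesgue_on {t0..}. 0 \<le> v t"
    and "recip_Linf_loc {t0..} v"
    and "z0 \<noteq> 0"
    and "(\<not> L1_at_infinity (\<lambda>t. 1 / v t) \<and> \<not> L1_at_infinity (\<lambda>t. A t * v t))
       \<or> (L1_at_infinity (\<lambda>t. 1 / v t) \<and>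
          (\<exists>T>t0. Limsup at_top
             (\<lambda>t. ereal (LINT s:{T..t}|lebesgue. sqrt (A s) - sqrt (chi v s))) = \<infinity>))"
    and "Lip_loc {t0..} z"
    and "solves_ode t0 A v z"
    and "z t0 = z0"
  shows "oscillatory t0 z"
proof (rule ccontr)
  assume "\<not> oscillatory t0 z"
  then obtain T0 where T0: "t0 \<le> T0" "\<And>t. T0 \<le> t \<Longrightarrow> z t \<noteq> 0"
    unfolding oscillatory_def by blast
  obtain w where w: "loc_abs_continuous_on {t0<..} w"
    "AE t in lebesgue_on {t0<..}. \<exists>z'. (z has_real_derivative z') (at t) \<and> w t = v t * z'"
    "AE t in lebesgue_on {t0<..}. (w has_real_derivative - (A t * v t * z t)) (at t)"
    using assms(11) unfolding solves_ode_def by blast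
  have "AE t in lebesgue_on {t0<..}. (\<exists>z'. (z has_real_derivative z') (at t) \<and> w t = v t * z') \<and>
      (w has_real_derivative - (A t * v t * z t)) (at t)"
    using w(2,3) by eventually_elim blast
  then obtain N1 where N1: "negligible N1" "\<And>t. t \<in> {t0<..} - N1 \<Longrightarrow>
      (\<exists>z'. (z has_real_derivative z') (at t) \<and> w t = v t * z') \<and>
      (w has_real_derivative - (A t * v t * z t)) (at t)"
    by (subst (asm) AE_lebesgue_on_iff_negligible) auto
  \<comment> \<open>Strict positivity combines \<open>0 \<le> v\<close> with the nonvanishing part
    of \<open>recip_Linf_loc\<close>.\<close>
  have "AE t in lebesgue_on {t0..}. 0 \<le> A t \<and> 0 < v t"
    using assms(3,6) assms(7)[unfolded recip_Linf_loc_def, THEN conjunct1]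
    by eventually_elim auto
  then obtain N2 where N2: "negligible N2" "\<And>t. t \<in> {t0..} - N2 \<Longrightarrow> 0 \<le> A t \<and> 0 < v t"
    by (subst (asm) AE_lebesgue_on_iff_negligible) auto
  define N where "N = N1 \<union> N2"
  have sc: "sturm_coefficients t0 A v N"
    using assms(2,5,7) N1(1) N2 unfolding N_def recip_Linf_loc_def
    by unfold_locales auto
  have ric: "riccati t0 A v N a (\<lambda>t. - (w t / z t))" if a: "t0 < a" "T0 \<le> a" for a
    using a T0(2) N1(2) by (intro solution_riccati[OF sc assms(10) a(1) _ w(1)]) (auto simp: N_def)
  show False
  proof (cases "L1_at_infinity (\<lambda>t. 1 / v t)")
    case False
    \<comment> \<open>\<open>T0\<close> may equal \<open>t0\<close>; adding 1 moves strictly into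
      the open half-line.\<close>
    interpret riccati t0 A v N "T0 + 1" "\<lambda>t. - (w t / z t)"
      using T0(1) by (intro ric) auto
    from L1_alternative False assms(9) show False by blast
  next
    case L1: True
    then obtain T where T: "t0 < T" "Limsup at_top
        (\<lambda>t. ereal (LINT s:{T..t}|lebesgue. sqrt (A s) - sqrt (chi v s))) = \<infinity>"
      using assms(9) by blast
    \<comment> \<open>Starting no earlier than \<open>T\<close> ensures \<open>T \<le> s\<close>
      below.\<close>
    interpret riccati t0 A v N "max T T0" "\<lambda>t. - (w t / z t)"
      using T(1) by (intro ric) auto
    obtain s K where s: "max T T0 \<le> s" and K: "\<And>t. s \<le> t \<Longrightarrow>
        integral {s..t} (\<lambda>u. sqrt (A u)) - integral {s..t} (\<lambda>u. sqrt (chi v u)) \<le> K"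
      using sqrt_integral_bounded[OF L1] by blast
    define g where "g u = sqrt (A u) - sqrt (chi v u)" for u
    have g: "g absolutely_integrable_on {T..t}" if "T \<le> t" for t
      unfolding g_def using T(1) that
      by (intro set_integral_diff sqrt_chi_integral(1)[OF L1]
          Linf_loc_absolutely_integrable[OF Linf_loc_sqrt[OF A_Linf]]) auto
    \<comment> \<open>Moving the lower limit from \<open>s\<close> back to \<open>T\<close> costs
      only a constant, so the limsup stays finite.\<close>
    have "(LINT u:{T..t}|lebesgue. g u) \<le> integral {T..s} g + K" if t: "s \<le> t" for t
    proof -
      have Tt: "T \<le> s" "T \<le> t" using s t by auto
      have "(LINT u:{T..t}|lebesgue. g u) = integral {T..t} g"
        using set_lebesgue_integral_eq_integral(2)[OF g[OF Tt(2)]] .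
      also have "\<dots> = integral {T..s} g + integral {s..t} g"
        using set_lebesgue_integral_eq_integral(1)[OF g[OF Tt(2)]] Tt t
        by (simp add: Henstock_Kurzweil_Integration.integral_combine)
      also have "integral {s..t} g = integral {s..t} (\<lambda>u. sqrt (A u)) - integral {s..t} (\<lambda>u. sqrt (chi v u))"
        unfolding g_def using T(1) Tt t
        by (intro Henstock_Kurzweil_Integration.integral_diff integrable_sqrt
            set_lebesgue_integral_eq_integral(1)[OF sqrt_chi_integral(1)[OF L1]]) auto
      also have "\<dots> \<le> K" using K[OF t] .
      finally show ?thesis by simp
    qed
    then have "\<forall>\<^sub>F t in at_top. ereal (LINT u:{T..t}|lebesgue. g u) \<le> ereal (integral {T..s} g + K)"
      unfolding eventually_at_top_linorder by auto
    then have "Limsup at_top (\<lambda>t. ereal (LINT u:{T..t}|lebesgue. g u)) \<le> ereal (integral {T..s} g + K)"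
      by (rule Limsup_bounded)
    moreover have "Limsup at_top (\<lambda>t. ereal (LINT u:{T..t}|lebesgue. g u)) = \<infinity>"
      unfolding g_def by (rule T(2))
    ultimately show False by simp
  qed
qed

end
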